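(* Let $n,m,k\ge 1$ be integers with $m+k-n\ge 1$. The map $$f(x_1,\dots,x_k)\ \longmapsto\ x_1\cdots x_k\, f(x_1^{-1},\dots,x_k^{-1})$$ defines a bijection between the diagrams $\mathcal V(n,m,k)$ and $\mathcal V(m+k-n,m,k)$.
   Context: A zonotope in $\mathbb R^n$ is a Minkowski sum of finitely many line segments (its generators); segments may degenerate to points. $\mathcal Z^n_m$ denotes the family of all zonotopes in $\mathbb R^n$ generated by at most $m$ segments; in particular $\mathcal Z^n_1$ is the family of segments (possibly points). $\mathrm{vol}$ is $n$-dimensional Euclidean volume in $\mathbb R^n$. For $A\in\mathcal Z^n_m$ and $B_1,\dots,B_k\in\mathcal Z^n_1$, the function $\mathrm{vol}(A+x_1B_1+\dots+x_kB_k)$ of $x_1,\dots,x_k\ge 0$ is a (generally nonhomogeneous) polynomial of degree at most one in each variable $x_i$ (the volume polynomial). The projection diagram is the set of polynomials $$\mathcal V(n,m,k)=\{\mathrm{vol}(A+x_1B_1+\dots+x_kB_k)\ :\ A\in\mathcal Z^n_m,\ B_1,\dots,B_k\in\mathcal Z^n_1\}.$$ *)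

theory Defs
  imports "HOL-Analysis.Analysis"
begin

text \<open>
  The sum below is the Minkowski sum of sets (from \<open>Set_Algebras\<close>); the empty sum is the point
  \<open>{0}\<close>. Degenerate segments \<open>closed_segment a a = {a}\<close> are allowed.
\<close>

definition zonotopes :: "nat \<Rightarrow> (real ^ 'n) set set" where
  "zonotopes m =
    {A. \<exists>r \<le> m. \<exists>a b :: nat \<Rightarrow> real ^ 'n. A = (\<Sum>j<r. closed_segment (a j) (b j))}"

text \<open>
  The diagram \<open>\<V>(n, m, k)\<close> with \<open>n = CARD('n)\<close> and \<open>k = CARD('k)\<close>. The volume is only considered
  for nonnegative \<open>x\<close>, whereas the elements of the diagram are polynomials: a polynomial in \<open>k\<close>
  real variables is represented by its polynomial function on all of \<open>real ^ 'k\<close>, which is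
  determined by its values on the nonnegative orthant.
\<close>

definition projection_diagram ::
  "'n::finite itself \<Rightarrow> nat \<Rightarrow> 'k::finite itself \<Rightarrow> (real ^ 'k \<Rightarrow> real) set" where
  "projection_diagram _ m _ =
    {f. real_polynomial_function f \<and>
        (\<exists>A \<in> zonotopes m :: (real ^ 'n) set set. \<exists>B :: 'k \<Rightarrow> (real ^ 'n) set.
          (\<forall>i. B i \<in> zonotopes 1) \<and>
          (\<forall>x. (\<forall>i. 0 \<le> x $ i) \<longrightarrow>
             f x = measure lebesgue (A + (\<Sum>i\<in>UNIV. (\<lambda>v. x $ i *\<^sub>R v) ` B i))))}"

end

theory Submission
  imports Defs
begin

text \<open>
  The volume of \<open>Z + t [0, v]\<close> is affine in \<open>t \<ge> 0\<close> for a compact convex \<open>Z\<close>: it is monotone, and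
  its increments do not depend on the starting point. Hence the volume of \<open>\<Sum> x\<^sub>e [0, v\<^sub>e]\<close> is affine
  in each \<open>x\<^sub>e\<close>, and, being homogeneous of degree \<open>n\<close>, it equals
  \<open>\<Sum>\<^bsub>|S| = n\<^esub> |det v\<^sub>S| \<Prod>\<^bsub>e \<in> S\<^esub> x\<^sub>e\<close>. The maximal minors of the \<open>n\<close> by \<open>m + k\<close> matrix \<open>v\<close> are,
  up to sign and a common factor, the complementary minors of its Gale dual, a \<open>m + k - n\<close> by
  \<open>m + k\<close> matrix, and complementing \<open>S\<close> is what the reciprocal substitution does to the monomials.
\<close>

section \<open>Volume gained by adding a segment to a compact convex set\<close>

text \<open>Additivity and nonnegativity make \<open>H\<close> monotone. Squeezing
  \<open>k * t\<close> between consecutive integers then bounds \<open>k * |H t - t * H 1|\<close>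
  by \<open>H 1\<close> for every \<open>k\<close>, so the difference vanishes.\<close>

lemma additive_nonneg_imp_linear:
  fixes H :: "real \<Rightarrow> real"
  assumes add: "\<And>s t. 0 \<le> s \<Longrightarrow> 0 \<le> t \<Longrightarrow> H (s + t) = H s + H t"
    and nonneg: "\<And>t. 0 \<le> t \<Longrightarrow> 0 \<le> H t" and "0 \<le> t"
  shows "H t = t * H 1"
proof -
  have H0: "H 0 = 0" using add[of 0 0] by simp
  have mult: "H (real k * s) = real k * H s" if "0 \<le> s" for k s
    by (induction k) (use that in \<open>auto simp: H0 add algebra_simps\<close>)
  have mono: "H s \<le> H u" if "0 \<le> s" "s \<le> u" for s u
    using add[of s "u - s"] nonneg[of "u - s"] that by simp
  have bound: "real k * \<bar>H t - t * H 1\<bar> \<le> H 1" for k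
  proof -
    define l where "l = nat \<lfloor>real k * t\<rfloor>"
    have l: "real l \<le> real k * t" "real k * t \<le> real l + 1"
      using \<open>0 \<le> t\<close> by (auto simp: l_def)
    have "real l * H 1 \<le> real k * H t"
      using mono[OF _ l(1)] mult[of 1 l] mult[of t k] \<open>0 \<le> t\<close> by simp
    moreover have "real k * H t \<le> (real l + 1) * H 1"
      using mono[OF _ l(2)] mult[of 1 "Suc l"] mult[of t k] \<open>0 \<le> t\<close> by (simp add: add.commute)
    moreover have "real l * H 1 \<le> real k * t * H 1" "real k * t * H 1 \<le> (real l + 1) * H 1"
      using l nonneg[of 1] by (auto intro: mult_right_mono)
    ultimately have "\<bar>real k * (H t - t * H 1)\<bar> \<le> H 1"
      by (simp add: algebra_simps)
    then show ?thesis by (simp add: abs_mult)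
  qed
  have "\<bar>H t - t * H 1\<bar> \<le> 0"
  proof (rule ccontr)
    assume "\<not> ?thesis"
    then obtain k where "H 1 < real k * \<bar>H t - t * H 1\<bar>"
      using reals_Archimedean3[of "\<bar>H t - t * H 1\<bar>"] by auto
    with bound[of k] show False by simp
  qed
  then show ?thesis by simp
qed

lemma closed_segment_zero_scaleR:
  assumes "0 \<le> t"
  shows "closed_segment 0 (t *\<^sub>R v) = {u *\<^sub>R v |u. 0 \<le> u \<and> u \<le> t}"
proof (cases "t = 0")
  case True
  then show ?thesis by auto
next
  case False
  have "\<exists>w. u *\<^sub>R v = w *\<^sub>R t *\<^sub>R v \<and> 0 \<le> w \<and> w \<le> 1" if "0 \<le> u" "u \<le> t" for u
    using that False assms by (intro exI[of _ "u / t"]) auto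
  moreover have "\<exists>u. w *\<^sub>R t *\<^sub>R v = u *\<^sub>R v \<and> 0 \<le> u \<and> u \<le> t" if "0 \<le> w" "w \<le> 1" for w
    using that assms by (intro exI[of _ "w * t"]) (auto intro: mult_left_le_one_le)
  ultimately show ?thesis
    unfolding closed_segment_def by (auto simp del: scaleR_scaleR; metis)
qed

lemma set_plus_closed_segment_zero_scaleR:
  assumes "0 \<le> t"
  shows "Z + closed_segment 0 (t *\<^sub>R v) = {z + u *\<^sub>R v |z u. z \<in> Z \<and> 0 \<le> u \<and> u \<le> t}"
  unfolding closed_segment_zero_scaleR[OF assms] by (force simp: set_plus_def)

lemma compact_set_plus:
  fixes A B :: "'a::real_normed_vector set"
  assumes "compact A" "compact B"
  shows "compact (A + B)"
proof -
  have "A + B = {x + y |x y. x \<in> A \<and> y \<in> B}" by (auto simp: set_plus_def)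
  then show ?thesis using compact_sums[OF assms] by simp
qed

text \<open>The region gained up to time \<open>s + t\<close> is the region gained up to
  \<open>s\<close> together with a disjoint translate of the one gained up to \<open>t\<close>. Its
  volume is therefore additive and nonnegative in the time, hence linear.\<close>

lemma measure_add_segment_affine:
  fixes Z :: "'a::euclidean_space set"
  assumes "compact Z" "convex Z" "0 \<le> t"
  shows "measure lebesgue (Z + closed_segment 0 (t *\<^sub>R v)) =
    measure lebesgue Z + t * (measure lebesgue (Z + closed_segment 0 v) - measure lebesgue Z)"
proof -
  let ?\<mu> = "measure lebesgue"
  define C where "C t = Z + closed_segment 0 (t *\<^sub>R v)" for t
  define D where "D t = C t - Z" for t
  have C: "C t = {z + u *\<^sub>R v |z u. z \<in> Z \<and> 0 \<le> u \<and> u \<le> t}" if "0 \<le> t" for t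
    unfolding C_def by (rule set_plus_closed_segment_zero_scaleR[OF that])
  have meas: "C t \<in> lmeasurable" for t
    unfolding C_def by (intro lmeasurable_compact compact_set_plus assms compact_segment)
  have Zm: "Z \<in> lmeasurable" using assms by (simp add: lmeasurable_compact)
  have sub: "Z \<subseteq> C t" if "0 \<le> t" for t
    unfolding C[OF that] using that by force
  have diff: "?\<mu> (D t) = ?\<mu> (C t) - ?\<mu> Z" if "0 \<le> t" for t
    unfolding D_def using sub[OF that] meas Zm by (intro measurable_measure_Diff) (auto simp: fmeasurableD)
  have Dm: "D t \<in> lmeasurable" for t
    unfolding D_def by (intro fmeasurable.Diff meas Zm)
  \<comment> \<open>What is gained between the times \<open>s\<close> and \<open>s + t\<close> is
    the gain up to \<open>t\<close>, moved by \<open>s *\<^sub>R v\<close>. Convexity of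
    \<open>Z\<close> ensures that the moved gain does not meet \<open>C s\<close>.\<close>
  have shift: "C (s + t) - C s = (+) (s *\<^sub>R v) ` D t" if st: "0 \<le> s" "0 \<le> t" for s t
  proof (intro equalityI subsetI)
    fix y assume y: "y \<in> C (s + t) - C s"
    have "0 \<le> s + t" using st by simp
    from C[OF this] y obtain z u where zu: "y = z + u *\<^sub>R v" "z \<in> Z" "0 \<le> u" "u \<le> s + t"
      by auto
    have "s < u" using y zu C[OF st(1)] by force
    then have "y - s *\<^sub>R v = z + (u - s) *\<^sub>R v" "0 \<le> u - s" "u - s \<le> t"
      using zu by (auto simp: algebra_simps)
    then have "y - s *\<^sub>R v \<in> C t" using C[OF st(2)] zu(2) by blast
    moreover have "y - s *\<^sub>R v \<notin> Z"
    proof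
      assume "y - s *\<^sub>R v \<in> Z"
      then have "(y - s *\<^sub>R v) + s *\<^sub>R v \<in> C s" using C[OF st(1)] st by blast
      then show False using y by simp
    qed
    ultimately show "y \<in> (+) (s *\<^sub>R v) ` D t"
      unfolding D_def by (intro image_eqI[of _ _ "y - s *\<^sub>R v"]) auto
  next
    fix y assume "y \<in> (+) (s *\<^sub>R v) ` D t"
    then obtain d where d: "y = s *\<^sub>R v + d" "d \<in> C t" "d \<notin> Z" by (auto simp: D_def)
    then obtain z u where zu: "d = z + u *\<^sub>R v" "z \<in> Z" "0 \<le> u" "u \<le> t"
      using C[OF st(2)] by auto
    have "y = z + (s + u) *\<^sub>R v" using d zu by (simp add: algebra_simps)
    moreover have "0 \<le> s + u" "s + u \<le> s + t" using zu st by auto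
    ultimately have "y \<in> C (s + t)" using zu(2) st C[of "s + t"] by (smt (verit) mem_Collect_eq)
    moreover have "y \<notin> C s"
    proof
      assume "y \<in> C s"
      then obtain z' w where w: "y = z' + w *\<^sub>R v" "z' \<in> Z" "0 \<le> w" "w \<le> s"
        using C[OF st(1)] by auto
      have z': "z' = z + (u + (s - w)) *\<^sub>R v"
        using d zu w by (simp add: algebra_simps)
      have "d \<in> Z"
      proof (cases "u = 0")
        case False
        \<comment> \<open>Along the direction \<open>v\<close> the point \<open>d\<close> lies
          between \<open>z\<close> and \<open>z'\<close>; \<open>r\<close> is its position on that
          segment. As both ends lie in \<open>Z\<close>, so does \<open>d\<close>, against its
          choice.\<close>
        define r where "r = u / (u + (s - w))"
        have pos: "0 < u + (s - w)" using False zu w by simp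
        then have r: "0 \<le> r" "r \<le> 1" "r * (u + (s - w)) = u"
          using zu w by (auto simp: r_def)
        have "(1 - r) *\<^sub>R z + r *\<^sub>R z' = z + (r * (u + (s - w))) *\<^sub>R v"
          unfolding z' by (simp add: algebra_simps)
        then have "d = (1 - r) *\<^sub>R z + r *\<^sub>R z'" using r zu by simp
        then show ?thesis
          using convexD_alt[OF assms(2) zu(2) w(2) r(1,2)] by simp
      qed (use zu in simp)
      with d show False by simp
    qed
    ultimately show "y \<in> C (s + t) - C s" by simp
  qed
  have mono: "C s \<subseteq> C (s + t)" if "0 \<le> s" "0 \<le> t" for s t
    using C[of s] C[of "s + t"] that by force
  have add: "?\<mu> (D (s + t)) = ?\<mu> (D s) + ?\<mu> (D t)" if "0 \<le> s" "0 \<le> t" for s t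
  proof -
    have "?\<mu> (C (s + t) - C s) = ?\<mu> (C (s + t)) - ?\<mu> (C s)"
      using mono[OF that] meas by (intro measurable_measure_Diff) (auto simp: fmeasurableD)
    moreover have "?\<mu> (C (s + t) - C s) = ?\<mu> (D t)"
      unfolding shift[OF that] by (rule measure_translation)
    ultimately show ?thesis using that by (simp add: diff)
  qed
  have "?\<mu> (D t) = t * ?\<mu> (D 1)"
    by (rule additive_nonneg_imp_linear[where H = "\<lambda>t. ?\<mu> (D t)"]) (use add assms in auto)
  then show ?thesis
    using diff[OF assms(3)] diff[of 1] by (simp add: C_def)
qed

section \<open>Minkowski sums and scaling of volume\<close>

lemma closed_segment_eq_plus: "closed_segment a b = {a} + closed_segment 0 (b - a)"
  using closed_segment_translation[of a 0 "b - a"] by (simp add: set_plus_image image_def)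

lemma compact_set_sum:
  fixes B :: "'e \<Rightarrow> 'a::real_normed_vector set"
  shows "(\<And>i. i \<in> I \<Longrightarrow> compact (B i)) \<Longrightarrow> compact (sum B I)"
  by (induction I rule: infinite_finite_induct) (auto simp: compact_set_plus set_zero)

lemma image_linear_set_sum:
  assumes "linear f"
  shows "f ` sum B I = (\<Sum>i\<in>I. f ` B i)"
proof -
  have "f ` A + f ` B = f ` (A + B)" for A B
    by (auto simp: set_plus_def linear_add[OF assms] image_iff) (metis linear_add[OF assms])+
  from sum_set_linear[of "(`) f", OF this] show ?thesis
    using linear_0[OF assms] by (simp add: set_zero o_def)
qed

lemma measure_scaleR_image:
  fixes A :: "(real ^ 'n::finite) set"
  assumes "A \<in> lmeasurable"
  shows "measure lebesgue ((*\<^sub>R) t ` A) = \<bar>t\<bar> ^ CARD('n) * measure lebesgue A"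
proof -
  have "(*\<^sub>R) t = (\<lambda>x :: real ^ 'n. \<chi> i. t * x $ i)"
    by (simp add: fun_eq_iff vec_eq_iff)
  then show ?thesis using measure_stretch[OF assms, of "\<lambda>_. t"] by (simp add: power_abs)
qed

lemma closed_segment_zero_zero: "closed_segment 0 0 = (0 :: 'a::real_vector set)"
  by (simp add: set_zero)

section \<open>Expansion of multiaffine functions into square-free monomials\<close>

text \<open>Induction on the variables: one variable \<open>a\<close> is split off, and the constant
  term and the slope in \<open>a\<close> are multiaffine in the others. Demanding
  \<open>x i = 0\<close> outside \<open>I\<close> leaves a single argument in the base case.\<close>

lemma multiaffine_expansion:
  fixes F :: "('e \<Rightarrow> real) \<Rightarrow> real"
  assumes "finite I"
    and "\<And>x i t. i \<in> I \<Longrightarrow> (\<And>j. 0 \<le> x j) \<Longrightarrow> 0 \<le> t \<Longrightarrow>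
      F (x(i := t)) = F (x(i := 0)) + t * (F (x(i := 1)) - F (x(i := 0)))"
  shows "\<exists>c. \<forall>x. (\<forall>i. 0 \<le> x i) \<longrightarrow> (\<forall>i. i \<notin> I \<longrightarrow> x i = 0) \<longrightarrow>
    F x = (\<Sum>S\<in>Pow I. c S * prod x S)"
  using assms
proof (induction I arbitrary: F)
  case empty
  show ?case
  proof (intro exI[of _ "\<lambda>_. F (\<lambda>_. 0)"] allI impI)
    fix x :: "'e \<Rightarrow> real" assume "\<forall>i. i \<notin> {} \<longrightarrow> x i = 0"
    then have "x = (\<lambda>_. 0)" by auto
    then have "F x = F (\<lambda>_. 0)" by (rule arg_cong)
    then show "F x = (\<Sum>S\<in>Pow {}. F (\<lambda>_. 0) * prod x S)" by simp
  qed
next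
  case (insert a J F)
  have aff: "F (x(i := t)) = F (x(i := 0)) + t * (F (x(i := 1)) - F (x(i := 0)))"
    if "i \<in> insert a J" "\<And>j. 0 \<le> x j" "0 \<le> t" for x i t
    using insert.prems that by blast
  \<comment> \<open>\<open>F0\<close> is the constant term and \<open>F1\<close> the slope of
    \<open>F\<close> in coordinate \<open>a\<close>. Both fix that coordinate at 0 or 1, which
    preserves affinity in the remaining ones.\<close>
  define F0 where "F0 x = F (x(a := 0))" for x
  define F1 where "F1 x = F (x(a := 1)) - F (x(a := 0))" for x
  have aff': "F (x(i := t, a := b)) =
      F (x(i := 0, a := b)) + t * (F (x(i := 1, a := b)) - F (x(i := 0, a := b)))"
    if "i \<in> J" "\<forall>j. 0 \<le> x j" "0 \<le> t" "0 \<le> b" for x i t b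
  proof -
    have "i \<noteq> a" using that insert.hyps by auto
    then show ?thesis
      using aff[of i "x(a := b)" t] that by (simp add: fun_upd_twist[of i a])
  qed
  have "\<exists>c. \<forall>x. (\<forall>i. 0 \<le> x i) \<longrightarrow> (\<forall>i. i \<notin> J \<longrightarrow> x i = 0) \<longrightarrow> F0 x = (\<Sum>S\<in>Pow J. c S * prod x S)"
    by (rule insert.IH) (unfold F0_def, rule aff', auto)
  then obtain c0 where c0: "\<And>x. (\<forall>i. 0 \<le> x i) \<Longrightarrow> (\<forall>i. i \<notin> J \<longrightarrow> x i = 0) \<Longrightarrow>
    F0 x = (\<Sum>S\<in>Pow J. c0 S * prod x S)" by blast
  have "\<exists>c. \<forall>x. (\<forall>i. 0 \<le> x i) \<longrightarrow> (\<forall>i. i \<notin> J \<longrightarrow> x i = 0) \<longrightarrow> F1 x = (\<Sum>S\<in>Pow J. c S * prod x S)"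
  proof (rule insert.IH)
    fix x :: "'e \<Rightarrow> real" and i and t :: real assume "i \<in> J" "\<And>j. 0 \<le> x j" "0 \<le> t"
    then have "i \<in> J" "\<forall>j. 0 \<le> x j" "0 \<le> t" by simp_all
    from aff'[OF this, of 0] aff'[OF this, of 1]
    show "F1 (x(i := t)) = F1 (x(i := 0)) + t * (F1 (x(i := 1)) - F1 (x(i := 0)))"
      unfolding F1_def by (simp add: algebra_simps)
  qed
  then obtain c1 where c1: "\<And>x. (\<forall>i. 0 \<le> x i) \<Longrightarrow> (\<forall>i. i \<notin> J \<longrightarrow> x i = 0) \<Longrightarrow>
    F1 x = (\<Sum>S\<in>Pow J. c1 S * prod x S)" by blast
  \<comment> \<open>Monomials containing \<open>a\<close> come from \<open>x a * F1\<close>, all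
    others from \<open>F0\<close>.\<close>
  define c where "c S = (if a \<in> S then c1 (S - {a}) else c0 S)" for S
  have "F x = (\<Sum>S\<in>Pow (insert a J). c S * prod x S)"
    if x: "\<forall>i. 0 \<le> x i" "\<forall>i. i \<notin> insert a J \<longrightarrow> x i = 0" for x
  proof -
    let ?x = "x(a := 0)"
    have "F x = F0 ?x + x a * F1 ?x"
      using aff[of a x "x a"] x by (simp add: F0_def F1_def)
    also have "F0 ?x = (\<Sum>S\<in>Pow J. c0 S * prod ?x S)" by (rule c0) (use x in auto)
    also have "\<dots> = (\<Sum>S\<in>Pow J. c S * prod x S)"
    proof (intro sum.cong refl)
      fix S assume "S \<in> Pow J"
      then have "a \<notin> S" using insert.hyps by auto
      then show "c0 S * prod ?x S = c S * prod x S"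
        by (auto simp: c_def intro!: prod.cong)
    qed
    also have "F1 ?x = (\<Sum>S\<in>Pow J. c1 S * prod ?x S)" by (rule c1) (use x in auto)
    also have "x a * \<dots> = (\<Sum>S\<in>Pow J. c (insert a S) * prod x (insert a S))"
      unfolding sum_distrib_left
    proof (intro sum.cong refl)
      fix S assume "S \<in> Pow J"
      then have "a \<notin> S" "finite S" using insert.hyps finite_subset by auto
      moreover from this have "prod ?x S = prod x S" by (auto intro!: prod.cong)
      ultimately show "x a * (c1 S * prod ?x S) = c (insert a S) * prod x (insert a S)"
        by (simp add: c_def)
    qed
    also have "\<dots> = (\<Sum>S\<in>insert a ` Pow J. c S * prod x S)"
      by (rule sum.reindex_cong[of "insert a" "Pow J", symmetric])
         (use insert.hyps in \<open>auto simp: inj_on_def\<close>)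
    also have "(\<Sum>S\<in>Pow J. c S * prod x S) + \<dots> = (\<Sum>S\<in>Pow (insert a J). c S * prod x S)"
      unfolding Pow_insert
      by (rule sum.union_disjoint[symmetric]) (use insert.hyps in auto)
    finally show ?thesis .
  qed
  then show ?case by blast
qed

section \<open>Determinants and volume under linear maps\<close>

text \<open>In the Leibniz formula only permutations fixing every index outside
  \<open>range h\<close> survive. They are the permutations of \<open>'n\<close> carried along
  \<open>h\<close>, with unchanged sign. The map \<open>h\<close> allows the smaller determinant to
  live on another index type.\<close>

lemma det_unit_rows:
  fixes A :: "'a::comm_ring_1^'N^'N" and h :: "'n::finite \<Rightarrow> 'N::finite"
  assumes h: "inj h" and unit: "\<And>i. i \<notin> range h \<Longrightarrow> A $ i = axis i 1"
  shows "det A = det (\<chi> i j. A $ h i $ h j)"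
proof -
  have bij: "bij_betw h UNIV (range h)" using h by (simp add: bij_betw_def)
  have "det A = (\<Sum>p | p permutes UNIV. of_int (sign p) * (\<Prod>i\<in>UNIV. A $ i $ p i))"
    by (simp add: det_def)
  also have "\<dots> = (\<Sum>p | p permutes range h. of_int (sign p) * (\<Prod>i\<in>UNIV. A $ i $ p i))"
  proof (rule sum.mono_neutral_right)
    show "{p. p permutes range h} \<subseteq> {p. p permutes UNIV}"
      by (auto intro: permutes_subset)
    show "\<forall>p\<in>{p. p permutes UNIV} - {p. p permutes range h}.
        of_int (sign p) * (\<Prod>i\<in>UNIV. A $ i $ p i) = 0"
    proof
      fix p :: "'N \<Rightarrow> 'N"
      assume p: "p \<in> {p. p permutes UNIV} - {p. p permutes range h}"
      then obtain i where i: "i \<notin> range h" "p i \<noteq> i"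
        by (metis Diff_iff mem_Collect_eq permutes_superset UNIV_I Diff_iff)
      then have "A $ i $ p i = 0" by (simp add: unit axis_def)
      then have "(\<Prod>i\<in>UNIV. A $ i $ p i) = 0" by (intro prod_zero) auto
      then show "of_int (sign p) * (\<Prod>i\<in>UNIV. A $ i $ p i) = 0" by simp
    qed
  qed auto
  also have "\<dots> = (\<Sum>q | q permutes UNIV. of_int (sign (map_permutation UNIV h q)) *
      (\<Prod>i\<in>UNIV. A $ i $ map_permutation UNIV h q i))"
  proof (rule sum.reindex_bij_betw[symmetric])
    \<comment> \<open>This is the explicit form in which \<open>bij_betw_permutations\<close>
      transports permutations along a bijection.\<close>
    have "map_permutation UNIV h =
      (\<lambda>\<pi> x. if x \<in> range h then h (\<pi> (inv_into UNIV h x)) else x)"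
      by (auto simp: map_permutation_def restrict_id_def fun_eq_iff)
    then show "bij_betw (map_permutation UNIV h) {q. q permutes UNIV} {p. p permutes range h}"
      using bij_betw_permutations[OF bij] by simp
  qed
  also have "\<dots> = (\<Sum>q | q permutes UNIV. of_int (sign q) * (\<Prod>i\<in>UNIV. A $ h i $ h (q i)))"
  proof (intro sum.cong refl arg_cong2[of _ _ _ _ "(*)"])
    fix q assume "q \<in> {q. q permutes (UNIV :: 'n set)}"
    then have q: "q permutes UNIV" by simp
    show "of_int (sign (map_permutation UNIV h q)) = of_int (sign q)"
      using sign_map_permutation[OF h q] by simp
    have "(\<Prod>i\<in>UNIV. A $ i $ map_permutation UNIV h q i) =
      (\<Prod>i\<in>range h. A $ i $ map_permutation UNIV h q i)"
      by (rule prod.mono_neutral_right)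
         (auto simp: unit axis_def map_permutation_def restrict_id_def)
    also have "\<dots> = (\<Prod>i\<in>UNIV. A $ h i $ h (q i))"
      by (subst prod.reindex[OF h]) (auto simp: map_permutation_def restrict_id_def inv_f_f[OF h])
    finally show "(\<Prod>i\<in>UNIV. A $ i $ map_permutation UNIV h q i) =
      (\<Prod>i\<in>UNIV. A $ h i $ h (q i))" .
  qed
  also have "\<dots> = det (\<chi> i j. A $ h i $ h j)" by (simp add: det_def)
  finally show ?thesis .
qed

lemma measure_shear_box:
  fixes a b :: "real ^ 'n::finite"
  assumes "m \<noteq> n"
  shows "measure lebesgue ((\<lambda>x. \<chi> i. if i = m then x $ m + x $ n else x $ i) ` cbox a b) =
    measure lebesgue (cbox a b)"
proof (cases "cbox a b = {}")
  case False
  let ?f = "\<lambda>x :: real ^ 'n. \<chi> i. if i = m then x $ m + x $ n else x $ i"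
  \<comment> \<open>Shifting by \<open>d\<close> moves the lower corner to \<open>n\<close>-th
    coordinate 0, which meets the sign condition of \<open>measure_shear_interval\<close>. The shear
    is additive, so it turns this shift into another shift.\<close>
  define d :: "real ^ 'n" where "d = axis n (a $ n)"
  have box: "cbox a b = (+) d ` cbox (a - d) (b - d)"
    by (subst cbox_translation[symmetric]) simp
  have "?f (d + x) = ?f d + ?f x" for x
    by (simp add: vec_eq_iff)
  then have "?f ` cbox a b = (+) (?f d) ` ?f ` cbox (a - d) (b - d)"
    unfolding box image_image by simp
  then have "measure lebesgue (?f ` cbox a b) = measure lebesgue (?f ` cbox (a - d) (b - d))"
    by (simp only: measure_translation)
  also have "\<dots> = measure lebesgue (cbox (a - d) (b - d))"
    by (rule measure_shear_interval) (use assms False box in \<open>auto simp: d_def\<close>)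
  also have "\<dots> = measure lebesgue (cbox a b)"
    unfolding box by (rule measure_translation[symmetric])
  finally show ?thesis .
qed simp

lemma measure_swap_box:
  fixes a b :: "real ^ 'n::finite"
  shows "measure lebesgue ((\<lambda>x. \<chi> i. x $ Transposition.transpose m n i) ` cbox a b) =
    measure lebesgue (cbox a b)"
proof -
  let ?s = "Transposition.transpose m n"
  let ?f = "\<lambda>x :: real ^ 'n. \<chi> i. x $ ?s i"
  have inv: "?f (?f x) = x" for x by (simp add: vec_eq_iff)
  have all: "(\<forall>i. Q (?s i)) \<longleftrightarrow> (\<forall>i. Q i)" for Q by (metis transpose_involutory)
  have mem: "?f x \<in> cbox (?f a) (?f b) \<longleftrightarrow> x \<in> cbox a b" for x
    using all[of "\<lambda>i. a $ i \<le> x $ i \<and> x $ i \<le> b $ i"] by (simp add: mem_box_cart)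
  have "?f ` cbox a b = cbox (?f a) (?f b)"
  proof (intro equalityI subsetI)
    fix y assume "y \<in> cbox (?f a) (?f b)"
    then show "y \<in> ?f ` cbox a b"
      using mem[of "?f y"] inv[of y] by (intro image_eqI[of _ _ "?f y"]) auto
  qed (use mem in auto)
  moreover have "(\<Prod>i\<in>UNIV. b $ ?s i - a $ ?s i) = (\<Prod>i\<in>UNIV. b $ i - a $ i)"
    by (rule prod.reindex_bij_betw) simp
  moreover have "cbox (?f a) (?f b) = {} \<longleftrightarrow> cbox a b = {}"
    using calculation(1) by (metis image_is_empty)
  ultimately show ?thesis
    by (simp add: content_cbox_if_cart)
qed

text \<open>The library proves this only for index types of class \<open>wellorder\<close>.\<close>
lemma measure_linear_image_cart:
  fixes f :: "real ^ 'n::finite \<Rightarrow> real ^ 'n"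
  assumes "linear f" "S \<in> lmeasurable"
  shows "measure lebesgue (f ` S) = \<bar>det (matrix f)\<bar> * measure lebesgue S"
proof -
  \<comment> \<open>Measurability of the image is part of \<open>P\<close> so that, for a
    composition, the outer map can be applied to the image under the inner one.\<close>
  define P :: "(real ^ 'n \<Rightarrow> real ^ 'n) \<Rightarrow> bool" where
    "P f \<longleftrightarrow> (\<forall>S\<in>lmeasurable. f ` S \<in> lmeasurable \<and>
      measure lebesgue (f ` S) = \<bar>det (matrix f)\<bar> * measure lebesgue S)" for f
  have box: "P f"
    if "linear f" and boxes: "\<And>a b. measure lebesgue (f ` cbox a b) = measure lebesgue (cbox a b)"
      and "\<bar>det (matrix f)\<bar> = 1" for f
  proof -
    have "f ` S \<in> lmeasurable \<and> measure lebesgue (f ` S) = 1 * measure lebesgue S"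
      if S: "S \<in> lmeasurable" for S
      using measure_linear_sufficient[OF \<open>linear f\<close> S, of 1] boxes by fastforce
    then show ?thesis by (simp add: P_def that(3))
  qed
  have "P f"
  proof (rule induct_linear_elementary[OF \<open>linear f\<close>])
    fix f g :: "real ^ 'n \<Rightarrow> real ^ 'n"
    assume "linear f" "linear g" "P f" "P g"
    then show "P (f \<circ> g)"
      unfolding P_def image_comp[symmetric] by (simp add: matrix_compose det_mul abs_mult)
  next
    fix f :: "real ^ 'n \<Rightarrow> real ^ 'n" and i
    assume f: "linear f" "\<And>x. f x $ i = 0"
    \<comment> \<open>A map with a vanishing coordinate is singular: its images are negligible and
      its determinant is 0.\<close>
    then have "\<not> surj f"
      by (metis one_neq_zero surjE vec_component)
    then have "\<not> inj f" using f linear_injective_imp_surjective by blast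
    then show "P f"
      using negligible_linear_singular_image[OF f(1)] det_nz_iff_inj[OF f(1)]
      by (simp add: P_def negligible_iff_measure)
  next
    fix c :: "'n \<Rightarrow> real"
    have "det (matrix (\<lambda>x. \<chi> i. c i * x $ i)) = prod c UNIV"
      by (subst det_diagonal) (auto simp: matrix_def axis_def)
    then show "P (\<lambda>x. \<chi> i. c i * x $ i)" by (simp add: P_def measure_stretch measurable_stretch)
  next
    fix m n :: 'n
    let ?f = "\<lambda>x :: real ^ 'n. \<chi> i. x $ Transposition.transpose m n i"
    have "linear ?f" by (rule linearI) (simp_all add: vec_eq_iff)
    moreover have "matrix ?f = (\<chi> i. mat 1 $ Transposition.transpose m n i)"
      by (auto simp: vec_eq_iff matrix_def axis_def mat_def)
    ultimately show "P ?f"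
      by (intro box measure_swap_box) (simp_all add: det_permute_rows permutes_swap_id sign_swap_id abs_mult)
  next
    fix m n :: 'n
    assume "m \<noteq> n"
    let ?f = "\<lambda>x :: real ^ 'n. \<chi> i. if i = m then x $ m + x $ n else x $ i"
    have "linear ?f" by (rule linearI) (simp_all add: vec_eq_iff algebra_simps)
    moreover have "matrix ?f =
      (\<chi> k. if k = m then row m (mat 1) + 1 *s row n (mat 1) else row k (mat 1))"
      by (auto simp: vec_eq_iff matrix_def axis_def mat_def row_def)
    then have "det (matrix ?f) = 1" by (simp only: det_row_operation[OF \<open>m \<noteq> n\<close>] det_I)
    ultimately show "P ?f" using \<open>m \<noteq> n\<close> by (intro box measure_shear_box) simp_all
  qed
  then show ?thesis using assms(2) by (simp add: P_def)
qed

section \<open>The volume of a zonotope as a polynomial\<close>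

text \<open>Multiaffinity gives a sum over all subsets of \<open>E\<close>, homogeneity keeps those
  of size \<open>CARD('n)\<close>, and evaluation at indicator vectors identifies the coefficients
  as volumes of parallelepipeds.\<close>

lemma zonotope_volume:
  fixes v :: "'e \<Rightarrow> real ^ 'n::finite"
  assumes "finite E" and "\<And>e. e \<in> E \<Longrightarrow> 0 \<le> x e"
  shows "measure lebesgue (\<Sum>e\<in>E. closed_segment 0 (x e *\<^sub>R v e)) =
    (\<Sum>S | S \<subseteq> E \<and> card S = CARD('n).
      measure lebesgue (\<Sum>e\<in>S. closed_segment 0 (v e)) * prod x S)"
proof -
  define F where "F x = measure lebesgue (\<Sum>e\<in>E. closed_segment 0 (x e *\<^sub>R v e))" for x
  have compact: "compact (\<Sum>e\<in>I. closed_segment 0 (x e *\<^sub>R v e))" for I x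
    by (intro compact_set_sum compact_segment)
  have aff: "F (x(i := t)) = F (x(i := 0)) + t * (F (x(i := 1)) - F (x(i := 0)))"
    if "i \<in> E" "0 \<le> t" for x i t
  proof -
    define Z where "Z = (\<Sum>e\<in>E - {i}. closed_segment 0 (x e *\<^sub>R v e))"
    have F: "F (x(i := s)) = measure lebesgue (Z + closed_segment 0 (s *\<^sub>R v i))" for s
    proof -
      have "(\<Sum>e\<in>E - {i}. closed_segment 0 ((x(i := s)) e *\<^sub>R v e)) = Z"
        unfolding Z_def by (intro sum.cong) auto
      then show ?thesis
        unfolding F_def using \<open>finite E\<close> that
        by (simp add: sum.remove[of E i] add.commute)
    qed
    have "compact Z" "convex Z"
      unfolding Z_def using compact by (auto intro!: convex_set_sum)
    from measure_add_segment_affine[OF this \<open>0 \<le> t\<close>, of "v i"]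
    show ?thesis unfolding F by (simp add: closed_segment_zero_zero)
  qed
  have "\<exists>c. \<forall>x. (\<forall>i. 0 \<le> x i) \<longrightarrow> (\<forall>i. i \<notin> E \<longrightarrow> x i = 0) \<longrightarrow>
    F x = (\<Sum>S\<in>Pow E. c S * prod x S)"
    by (rule multiaffine_expansion[OF \<open>finite E\<close>]) (rule aff)
  then obtain c where c: "\<And>x. (\<forall>i. 0 \<le> x i) \<Longrightarrow> (\<forall>i. i \<notin> E \<longrightarrow> x i = 0) \<Longrightarrow>
    F x = (\<Sum>S\<in>Pow E. c S * prod x S)" by blast
  have scale: "F (\<lambda>e. t * x e) = t ^ CARD('n) * F x" if "0 \<le> t" for t x
  proof -
    have "(\<Sum>e\<in>E. closed_segment 0 ((t * x e) *\<^sub>R v e)) =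
      (*\<^sub>R) t ` (\<Sum>e\<in>E. closed_segment 0 (x e *\<^sub>R v e))"
      by (simp add: image_linear_set_sum closed_segment_linear_image[symmetric])
    then show ?thesis
      unfolding F_def using that compact
      by (simp add: measure_scaleR_image lmeasurable_compact)
  qed
  let ?P = "{S. S \<subseteq> E \<and> card S = CARD('n)}"
  have hom: "F x = (\<Sum>S\<in>?P. c S * prod x S)"
    if x: "\<forall>i. 0 \<le> x i" "\<forall>i. i \<notin> E \<longrightarrow> x i = 0" for x
  proof -
    \<comment> \<open>For fixed \<open>x\<close>, \<open>p\<close> is the difference of the two
      expressions for \<open>F\<close> at the multiple of \<open>x\<close> by \<open>t\<close>, as a
      polynomial in \<open>t\<close>. It vanishes for all \<open>t \<ge> 0\<close>, so its
      coefficient of degree \<open>CARD('n)\<close> is 0.\<close>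
    define p where "p = (\<Sum>S\<in>Pow E. monom (c S * prod x S) (card S)) - monom (F x) (CARD('n))"
    have "poly p t = 0" if "0 \<le> t" for t
    proof -
      have "F (\<lambda>e. t * x e) = (\<Sum>S\<in>Pow E. c S * prod x S * t ^ card S)"
        by (subst c) (use x that in \<open>auto simp: prod.distrib algebra_simps\<close>)
      then show ?thesis
        using scale[OF that, of x] by (simp add: p_def poly_sum poly_monom mult.commute)
    qed
    then have "{0..} \<subseteq> {t. poly p t = 0}" by auto
    then have "infinite {t. poly p t = 0}"
      using infinite_Ici finite_subset by blast
    then have "p = 0" using poly_roots_finite by blast
    then have "coeff p (CARD('n)) = 0" by simp
    then have "F x = (\<Sum>S\<in>Pow E. if card S = CARD('n) then c S * prod x S else 0)"
      by (simp add: p_def coeff_sum)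
    also have "\<dots> = (\<Sum>S\<in>?P. c S * prod x S)"
      using \<open>finite E\<close> by (subst sum.inter_filter[symmetric]) auto
    finally show ?thesis .
  qed
  have coeff: "c S = measure lebesgue (\<Sum>e\<in>S. closed_segment 0 (v e))" if S: "S \<in> ?P" for S
  proof -
    \<comment> \<open>At the indicator of \<open>S\<close> a monomial \<open>T\<close> survives only
      if \<open>T \<subseteq> S\<close>, and equal cardinality then forces
      \<open>T = S\<close>.\<close>
    let ?x = "\<lambda>e. if e \<in> S then 1 else 0 :: real"
    have "finite S" using S \<open>finite E\<close> finite_subset by auto
    have "(\<Sum>e\<in>S. closed_segment 0 (v e)) = (\<Sum>e\<in>E. closed_segment 0 (?x e *\<^sub>R v e))"
      using S \<open>finite E\<close> by (intro sum.mono_neutral_cong_left) (auto simp: closed_segment_zero_zero)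
    then have "measure lebesgue (\<Sum>e\<in>S. closed_segment 0 (v e)) = F ?x"
      by (simp add: F_def)
    also have "\<dots> = (\<Sum>T\<in>?P. c T * prod ?x T)" by (rule hom) (use S in auto)
    also have "\<dots> = (\<Sum>T\<in>?P. if T = S then c S else 0)"
    proof (intro sum.cong refl)
      fix T assume T: "T \<in> ?P"
      then have "finite T" using \<open>finite E\<close> finite_subset by auto
      show "c T * prod ?x T = (if T = S then c S else 0)"
      proof (cases "T \<subseteq> S")
        case True
        then have "T = S" using S T \<open>finite S\<close> by (simp add: card_subset_eq)
        then show ?thesis by simp
      next
        case False
        then have "prod ?x T = 0" using \<open>finite T\<close> by (auto intro!: prod_zero)
        then show ?thesis using False by auto
      qed
    qed
    also have "\<dots> = c S" using S \<open>finite E\<close> by simp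
    finally show ?thesis by simp
  qed
  \<comment> \<open>\<open>hom\<close> wants arguments that are nonnegative everywhere and zero
    outside \<open>E\<close>; \<open>x\<close> is controlled only on \<open>E\<close>.\<close>
  let ?x = "\<lambda>e. if e \<in> E then x e else 0"
  have "measure lebesgue (\<Sum>e\<in>E. closed_segment 0 (x e *\<^sub>R v e)) = F ?x"
    unfolding F_def by (intro arg_cong[where f = "measure lebesgue"] sum.cong) auto
  also have "\<dots> = (\<Sum>S\<in>?P. c S * prod ?x S)"
    by (rule hom) (use assms in auto)
  also have "\<dots> = (\<Sum>S\<in>?P. measure lebesgue (\<Sum>e\<in>S. closed_segment 0 (v e)) * prod x S)"
    by (intro sum.cong refl arg_cong2[of _ _ _ _ "(*)"] coeff prod.cong) auto
  finally show ?thesis .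
qed

text \<open>The parallelepiped is the image of the unit cube under the matrix with columns
  \<open>u j\<close>.\<close>

lemma measure_parallelepiped:
  fixes u :: "'n::finite \<Rightarrow> real ^ 'n"
  shows "measure lebesgue (\<Sum>j\<in>UNIV. closed_segment 0 (u j)) = \<bar>det (\<chi> i j. u j $ i)\<bar>"
proof -
  let ?M = "\<chi> i j. u j $ i"
  have mult: "?M *v x = (\<Sum>j\<in>UNIV. x $ j *\<^sub>R u j)" for x
    by (simp add: vec_eq_iff matrix_vector_mult_def mult.commute)
  have "(\<Sum>j\<in>UNIV. closed_segment 0 (u j)) = (*v) ?M ` cbox 0 1" (is "?L = ?R")
  proof (intro equalityI subsetI)
    fix y assume "y \<in> ?L"
    then obtain s where s: "y = (\<Sum>j\<in>UNIV. s j)" "\<And>j. s j \<in> closed_segment 0 (u j)"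
      by (auto simp: set_sum_alt)
    then have "\<forall>j. \<exists>t. s j = t *\<^sub>R u j \<and> 0 \<le> t \<and> t \<le> 1"
      by (auto simp: in_segment)
    then obtain t where t: "\<And>j. s j = t j *\<^sub>R u j" "\<And>j. 0 \<le> t j" "\<And>j. t j \<le> 1" by metis
    have "y = ?M *v (\<chi> j. t j)" unfolding mult s by (simp add: t)
    then show "y \<in> ?R" using t by (intro image_eqI) (auto simp: mem_box_cart)
  next
    fix y assume "y \<in> ?R"
    then obtain x where "y = (\<Sum>j\<in>UNIV. x $ j *\<^sub>R u j)" "x \<in> cbox 0 1"
      by (auto simp: mult)
    then show "y \<in> ?L"
      unfolding set_sum_alt[OF finite] by (auto simp: in_segment mem_box_cart)
  qed
  then show ?thesis
    using measure_linear_image_cart[of "(*v) ?M" "cbox 0 1"]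
    by (simp add: content_cbox_if_cart interval_eq_empty_cart)
qed

section \<open>Gale duality for maximal minors\<close>

text \<open>\<open>M\<close> factors as \<open>A ** D\<close>: \<open>A\<close> keeps the upper rows
  of \<open>M\<close> and \<open>D\<close> the lower ones, with unit rows elsewhere.
  \<open>det_unit_rows\<close> reduces each factor to its diagonal block.\<close>

lemma det_block_lower_triangular:
  fixes M :: "'a::comm_ring_1^('n::finite + 'p::finite)^('n + 'p)"
  assumes "\<And>i j. M $ Inl i $ Inr j = 0"
  shows "det M = det (\<chi> i j. M $ Inl i $ Inl j :: 'a^'n^'n) *
    det (\<chi> i j. M $ Inr i $ Inr j :: 'a^'p^'p)"
proof -
  define A :: "'a^('n + 'p)^('n + 'p)" where
    "A = (\<chi> i. case i of Inl a \<Rightarrow> M $ Inl a | Inr b \<Rightarrow> axis (Inr b) 1)"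
  define D :: "'a^('n + 'p)^('n + 'p)" where
    "D = (\<chi> i. case i of Inl a \<Rightarrow> axis (Inl a) 1 | Inr b \<Rightarrow> M $ Inr b)"
  have "(A ** D) $ i $ j = M $ i $ j" for i j
  proof (cases i)
    case (Inl a)
    have "(A ** D) $ i $ j = (\<Sum>k\<in>UNIV. if k = j then M $ i $ k else 0)"
      unfolding matrix_matrix_mult_def vec_lambda_beta
    proof (intro sum.cong refl)
      fix k
      show "A $ i $ k * D $ k $ j = (if k = j then M $ i $ k else 0)"
        by (cases k) (auto simp: A_def D_def Inl assms axis_def)
    qed
    then show ?thesis by simp
  next
    case (Inr b)
    have "(A ** D) $ i $ j = (\<Sum>k\<in>UNIV. if k = i then D $ k $ j else 0)"
      unfolding matrix_matrix_mult_def vec_lambda_beta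
      by (intro sum.cong refl) (auto simp: A_def Inr axis_def)
    then show ?thesis by (simp add: D_def Inr)
  qed
  then have "M = A ** D" by (simp add: vec_eq_iff)
  moreover have "det A = det (\<chi> i j. M $ Inl i $ Inl j :: 'a^'n^'n)"
    by (subst det_unit_rows[of "Inl :: 'n \<Rightarrow> 'n + 'p"]) (auto simp: A_def image_iff split: sum.splits)
  moreover have "det D = det (\<chi> i j. M $ Inr i $ Inr j :: 'a^'p^'p)"
    by (subst det_unit_rows[of "Inr :: 'p \<Rightarrow> 'n + 'p"]) (auto simp: D_def image_iff split: sum.splits)
  ultimately show ?thesis by (simp add: det_mul)
qed

lemma sum_UNIV_Plus:
  fixes g :: "'a::finite + 'b::finite \<Rightarrow> 'c::comm_monoid_add"
  shows "(\<Sum>x\<in>UNIV. g x) = (\<Sum>a\<in>UNIV. g (Inl a)) + (\<Sum>b\<in>UNIV. g (Inr b))"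
  by (simp add: UNIV_Plus_UNIV[symmetric] sum.Plus del: UNIV_Plus_UNIV)

text \<open>If the columns of \<open>(U | B)\<close> are the vectors \<open>v\<close>, the columns of \<open>(- A\<^sup>T | I)\<close> with
  \<open>B = U A\<close> are their Gale dual \<open>w\<close>.\<close>
lemma abs_det_gale_dual:
  fixes v :: "'n::finite + 'p::finite \<Rightarrow> real ^ 'n" and \<sigma> :: "'n + 'p \<Rightarrow> 'n + 'p"
    and A :: "real ^ 'p ^ 'n"
  assumes B: "\<And>b. v (Inr b) = (\<Sum>a\<in>UNIV. A $ a $ b *\<^sub>R v (Inl a))"
    and \<sigma>: "\<sigma> permutes UNIV"
    and w_def: "\<And>j. w j = (case j of Inl a \<Rightarrow> - A $ a | Inr b \<Rightarrow> axis b 1)"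
  shows "\<bar>det (\<chi> i j. v (\<sigma> (Inl j)) $ i)\<bar> =
    \<bar>det (\<chi> i j. v (Inl j) $ i)\<bar> * \<bar>det (\<chi> i j. w (\<sigma> (Inr j)) $ i)\<bar>"
proof -
  \<comment> \<open>The determinant of \<open>K ** R'\<close> is computed twice.
    \<open>det K\<close> is the minor of \<open>v\<close> selected by \<sigma>, and
    \<open>R'\<close> is a unitriangular matrix with permuted rows. The product is block lower
    triangular, its diagonal blocks carrying the basis minor of \<open>v\<close> and the
    complementary minor of \<open>w\<close>.\<close>
  define K :: "real ^ ('n + 'p) ^ ('n + 'p)" where
    "K = (\<chi> i. case i of Inl a \<Rightarrow> (\<chi> j. v (\<sigma> j) $ a) | Inr b \<Rightarrow> axis (Inr b) 1)"
  define R :: "real ^ ('n + 'p) ^ ('n + 'p)" where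
    "R = (\<chi> j l. case l of Inl a \<Rightarrow> (if j = Inl a then 1 else 0) | Inr b \<Rightarrow> w j $ b)"
  define R' :: "real ^ ('n + 'p) ^ ('n + 'p)" where "R' = (\<chi> j. R $ \<sigma> j)"
  have "det K = det (\<chi> i j. v (\<sigma> (Inl j)) $ i)"
    by (subst det_unit_rows[of "Inl :: 'n \<Rightarrow> 'n + 'p"])
       (auto simp: K_def image_iff split: sum.splits)
  moreover have "\<bar>det R'\<bar> = 1"
  proof -
    have "det R = det (mat 1 :: real ^ 'n ^ 'n)"
      by (subst det_unit_rows[of "Inl :: 'n \<Rightarrow> 'n + 'p"])
         (auto simp: R_def w_def image_iff vec_eq_iff axis_def mat_def intro!: arg_cong[of _ _ det] split: sum.splits)
    then show ?thesis
      using det_permute_rows[OF \<sigma>, of R] by (simp add: R'_def abs_mult sign_def)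
  qed
  moreover have "det (K ** R') =
    det (\<chi> i j. v (Inl j) $ i) * det (\<chi> i j. w (\<sigma> (Inr j)) $ i)"
  proof -
    have top: "(K ** R') $ Inl a $ l = (\<Sum>j\<in>UNIV. v j $ a * R $ j $ l)" for a l
    proof -
      have "(K ** R') $ Inl a $ l = (\<Sum>j\<in>UNIV. v (\<sigma> j) $ a * R $ \<sigma> j $ l)"
        by (simp add: matrix_matrix_mult_def K_def R'_def)
      also have "\<dots> = (\<Sum>j\<in>UNIV. v j $ a * R $ j $ l)"
        by (rule sum.reindex_bij_betw[OF permutes_imp_bij[OF \<sigma>], of "\<lambda>j. v j $ a * R $ j $ l"])
      finally show ?thesis .
    qed
    have "(K ** R') $ Inl a $ Inl a' = v (Inl a') $ a" for a a'
    proof -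
      have "(K ** R') $ Inl a $ Inl a' = (\<Sum>j\<in>UNIV. if j = Inl a' then v j $ a else 0)"
        unfolding top by (intro sum.cong refl) (simp add: R_def)
      then show ?thesis by simp
    qed
    \<comment> \<open>This is the orthogonality of the rows of \<open>v\<close> to those of
      \<open>w\<close>, a restatement of \<open>B\<close>.\<close>
    moreover have "(K ** R') $ Inl a $ Inr b = 0" for a b
    proof -
      have "(\<Sum>b'\<in>UNIV. v (Inr b') $ a * axis b' 1 $ b) =
        (\<Sum>b'\<in>UNIV. if b' = b then v (Inr b') $ a else 0)"
        by (intro sum.cong refl) (simp add: axis_def)
      then show ?thesis
        unfolding top by (simp add: R_def w_def sum_UNIV_Plus B sum_negf mult.commute)
    qed
    moreover have "(K ** R') $ Inr b $ Inr b' = w (\<sigma> (Inr b)) $ b'" for b b'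
    proof -
      have "(K ** R') $ Inr b $ Inr b' = (\<Sum>j\<in>UNIV. if j = Inr b then R' $ j $ Inr b' else 0)"
        unfolding matrix_matrix_mult_def vec_lambda_beta
        by (intro sum.cong refl) (simp add: K_def axis_def)
      then show ?thesis by (simp add: R'_def R_def)
    qed
    moreover have "det (\<chi> i j. w (\<sigma> (Inr i)) $ j) = det (\<chi> i j. w (\<sigma> (Inr j)) $ i)"
      by (subst det_transpose[symmetric]) (simp add: transpose_def)
    ultimately show ?thesis
      by (subst det_block_lower_triangular) simp_all
  qed
  ultimately show ?thesis
    using det_mul[of K R'] by (metis abs_mult mult.right_neutral)
qed

lemma measure_parallelepiped_range:
  fixes h :: "'n::finite \<Rightarrow> 'e" and v :: "'e \<Rightarrow> real ^ 'n"
  assumes "inj h"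
  shows "measure lebesgue (\<Sum>e\<in>range h. closed_segment 0 (v e)) = \<bar>det (\<chi> i j. v (h j) $ i)\<bar>"
  using measure_parallelepiped[of "v \<circ> h"] by (simp add: sum.reindex[OF assms])

lemma bij_betw_case_sum:
  assumes "bij_betw f UNIV A" "bij_betw g UNIV B" "A \<inter> B = {}"
  shows "bij_betw (case_sum f g) UNIV (A \<union> B)"
proof -
  have "inj (case_sum f g)"
    using assms by (auto simp: inj_on_def bij_betw_def split: sum.splits)
  moreover have "range (case_sum f g) = A \<union> B"
    using assms by (auto simp: bij_betw_def UNIV_sum image_Un image_image)
  ultimately show ?thesis by (simp add: bij_betw_def)
qed

text \<open>A nondegenerate \<open>S0\<close> serves as a basis and is listed first. The Gale dual
  relative to it has the right complementary minors up to the factor \<open>|det U|\<close>, which a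
  rescaling of \<open>w\<close> absorbs.\<close>

lemma ex_gale_dual:
  fixes v :: "'e \<Rightarrow> real ^ 'n::finite"
  assumes "finite E" and card: "card E = CARD('n) + CARD('p::finite)"
  shows "\<exists>w :: 'e \<Rightarrow> real ^ 'p. \<forall>S. S \<subseteq> E \<longrightarrow> card S = CARD('n) \<longrightarrow>
    measure lebesgue (\<Sum>e\<in>S. closed_segment 0 (v e)) =
    measure lebesgue (\<Sum>e\<in>E - S. closed_segment 0 (w e))"
proof (cases "\<forall>S. S \<subseteq> E \<longrightarrow> card S = CARD('n) \<longrightarrow>
    measure lebesgue (\<Sum>e\<in>S. closed_segment 0 (v e)) = 0")
  case True
  \<comment> \<open>When every volume on the left is 0, \<open>w = 0\<close> works: each dual sum is
    a single point, of volume 0.\<close>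
  have "(\<Sum>e\<in>X. closed_segment 0 0) = {0 :: real ^ 'p}" for X :: "'e set"
    unfolding closed_segment_zero_zero sum.neutral_const by simp
  with True show ?thesis by (intro exI[of _ "\<lambda>_. 0"]) simp
next
  case False
  then obtain S0 where S0: "S0 \<subseteq> E" "card S0 = CARD('n)"
    "measure lebesgue (\<Sum>e\<in>S0. closed_segment 0 (v e)) \<noteq> 0" by blast
  have fin: "finite S0" "finite (E - S0)" using S0 assms finite_subset by auto
  obtain g1 :: "'n \<Rightarrow> 'e" where g1: "bij_betw g1 UNIV S0"
    using finite_same_card_bij[of "UNIV :: 'n set" S0] S0 fin by auto
  obtain g2 :: "'p \<Rightarrow> 'e" where g2: "bij_betw g2 UNIV (E - S0)"
    using finite_same_card_bij[of "UNIV :: 'p set" "E - S0"] S0 fin card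
    by (auto simp: card_Diff_subset)
  define g where "g = case_sum g1 g2"
  have g: "bij_betw g UNIV E"
    using bij_betw_case_sum[OF g1 g2] S0 by (simp add: g_def Un_absorb1)
  then have g_inj: "inj g" and g_range: "range g = E" by (auto simp: bij_betw_def)
  define u where "u = v \<circ> g"
  define U where "U = (\<chi> i j. u (Inl j) $ i)"
  define V where "V = (\<chi> i b. u (Inr b) $ i)"
  have "range (\<lambda>a. g (Inl a)) = S0" "inj (\<lambda>a. g (Inl a))"
    using g1 by (auto simp: g_def bij_betw_def)
  from measure_parallelepiped_range[OF this(2), of v] this(1)
  have detU: "det U \<noteq> 0" using S0(3) by (simp add: U_def u_def)
  then obtain U' where "U ** U' = mat 1" using invertible_det_nz invertible_def by blast
  \<comment> \<open>The columns of \<open>A\<close> are the coordinates of the vectors outside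
    \<open>S0\<close> in the basis given by \<open>S0\<close>.\<close>
  define A where "A = U' ** V"
  then have UA: "U ** A = V" using \<open>U ** U' = mat 1\<close> by (simp add: matrix_mul_assoc)
  have B: "u (Inr b) = (\<Sum>a\<in>UNIV. A $ a $ b *\<^sub>R u (Inl a))" for b
  proof -
    have "u (Inr b) $ i = (U ** A) $ i $ b" for i by (simp add: UA V_def)
    then show ?thesis
      by (simp add: vec_eq_iff matrix_matrix_mult_def U_def mult.commute)
  qed
  define w0 where "w0 j = (case j of Inl a \<Rightarrow> - A $ a | Inr b \<Rightarrow> axis b 1)" for j
  \<comment> \<open>Multiplying all dual vectors by \<open>r\<close> multiplies each of their
    maximal minors by \<open>r ^ CARD('p)\<close>, which is \<open>|det U|\<close>.\<close>
  define r where "r = root CARD('p) \<bar>det U\<bar>"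
  have r: "\<bar>r\<bar> ^ CARD('p) = \<bar>det U\<bar>" by (simp add: r_def)
  define w where "w e = r *\<^sub>R w0 (inv_into UNIV g e)" for e
  show ?thesis
  proof (intro exI[of _ w] allI impI)
    fix S assume S: "S \<subseteq> E" "card S = CARD('n)"
    define T where "T = g -` S"
    have gT: "g ` T = S" "g ` (- T) = E - S"
      using S(1) g_range g_inj by (auto simp: T_def)
    have "card T = CARD('n)"
      using card_image[OF inj_on_subset[OF g_inj], of T] gT S by simp
    moreover have "card (- T) = CARD('p)"
      using calculation by (simp add: Compl_eq_Diff_UNIV card_Diff_subset)
    ultimately obtain h1 :: "'n \<Rightarrow> 'n + 'p" and h2 :: "'p \<Rightarrow> 'n + 'p"
      where h: "bij_betw h1 UNIV T" "bij_betw h2 UNIV (- T)"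
      using finite_same_card_bij[of "UNIV :: 'n set" T]
        finite_same_card_bij[of "UNIV :: 'p set" "- T"] by auto
    \<comment> \<open>\<sigma> lists the positions of the elements of \<open>S\<close> first and
      those of the complement after them.\<close>
    define \<sigma> where "\<sigma> = case_sum h1 h2"
    have "bij \<sigma>" using bij_betw_case_sum[OF h] by (simp add: \<sigma>_def)
    then have \<sigma>: "\<sigma> permutes UNIV" by (intro bij_imp_permutes) auto
    have range: "range (\<lambda>j. g (h1 j)) = S" "range (\<lambda>j. g (h2 j)) = E - S"
      using h gT by (auto simp: bij_betw_def image_image[symmetric])
    have inj: "inj (\<lambda>j. g (h1 j))" "inj (\<lambda>j. g (h2 j))"
      using h g_inj by (auto simp: bij_betw_def inj_on_def)
    have "measure lebesgue (\<Sum>e\<in>S. closed_segment 0 (v e)) =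
        \<bar>det (\<chi> i j. u (\<sigma> (Inl j)) $ i)\<bar>"
      using measure_parallelepiped_range[OF inj(1), of v] by (simp add: range u_def \<sigma>_def)
    also have "\<dots> = \<bar>det U\<bar> * \<bar>det (\<chi> i j. w0 (h2 j) $ i)\<bar>"
      using abs_det_gale_dual[OF B \<sigma> w0_def] by (simp add: U_def \<sigma>_def)
    also have "\<dots> = \<bar>det (\<chi> i. r *s (\<chi> j. w0 (h2 j) $ i))\<bar>"
      by (subst det_rows_mul) (simp add: abs_mult power_abs r)
    also have "\<dots> = \<bar>det (\<chi> i j. w (g (h2 j)) $ i)\<bar>"
      by (intro arg_cong[of _ _ "\<lambda>M. \<bar>det M\<bar>"])
         (simp add: vec_eq_iff w_def inv_f_f[OF g_inj])
    also have "\<dots> = measure lebesgue (\<Sum>e\<in>E - S. closed_segment 0 (w e))"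
      using measure_parallelepiped_range[OF inj(2), of w] by (simp add: range)
    finally show "measure lebesgue (\<Sum>e\<in>S. closed_segment 0 (v e)) =
      measure lebesgue (\<Sum>e\<in>E - S. closed_segment 0 (w e))" .
  qed
qed

section \<open>Volume polynomials as the elements of the diagram\<close>

text \<open>On the line from the all-ones vector to \<open>x\<close> the difference of
  \<open>f\<close> and \<open>g\<close> is a univariate polynomial. It vanishes for all small
  \<open>t > 0\<close>, where the line is still in the open orthant, hence also at
  \<open>t = 1\<close>, which is \<open>x\<close>.\<close>

lemma real_polynomial_function_eqI:
  fixes f g :: "real ^ 'k::finite \<Rightarrow> real"
  assumes "real_polynomial_function f" "real_polynomial_function g"
    and eq: "\<And>x. (\<forall>i. 0 < x $ i) \<Longrightarrow> f x = g x"
  shows "f = g"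
proof
  fix x
  define L where "L t = (1 :: real ^ 'k) + t *\<^sub>R (x - 1)" for t :: real
  have "polynomial_function L"
    unfolding L_def
    by (intro polynomial_function_add polynomial_function_const polynomial_function_mult
        polynomial_function_id)
  then have "real_polynomial_function ((\<lambda>y. f y - g y) \<circ> L)"
    using assms by (intro real_polynomial_function_compose real_polynomial_function_diff)
  then obtain a n where a: "(\<lambda>y. f y - g y) \<circ> L = (\<lambda>t. \<Sum>i\<le>n. a i * t ^ i)"
    using real_polynomial_function_imp_sum by blast
  define p where "p = (\<Sum>i\<le>n. monom (a i) i)"
  have p: "poly p t = f (L t) - g (L t)" for t
    using fun_cong[OF a, of t] by (simp add: p_def poly_sum poly_monom)
  \<comment> \<open>For \<open>t\<close> below this bound \<open>t * norm (x - 1) < 1\<close>, so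
    all coordinates of \<open>L t\<close> stay positive. The summand 1 keeps the denominator
    positive when \<open>x = 1\<close>.\<close>
  define \<delta> where "\<delta> = 1 / (1 + norm (x - 1))"
  have pos: "0 < 1 + norm (x - 1)" by (smt (verit) norm_ge_zero)
  then have "0 < \<delta>" by (simp add: \<delta>_def)
  have "poly p t = 0" if t: "0 < t" "t < \<delta>" for t
  proof -
    have "0 < L t $ i" for i
    proof -
      have "t * \<bar>(x - 1) $ i\<bar> \<le> t * norm (x - 1)"
        using t by (intro mult_left_mono component_le_norm_cart) auto
      also have "\<dots> \<le> t * (1 + norm (x - 1))" using t by simp
      also have "\<dots> < 1" using t pos by (simp add: \<delta>_def field_simps)
      finally have "\<bar>t * (x - 1) $ i\<bar> < 1" using t by (simp add: abs_mult)
      then show ?thesis by (simp add: L_def abs_less_iff)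
    qed
    then show ?thesis using p eq by simp
  qed
  then have "{0<..<\<delta>} \<subseteq> {t. poly p t = 0}" by auto
  then have "infinite {t. poly p t = 0}"
    using \<open>0 < \<delta>\<close> infinite_Ioo finite_subset by blast
  then have "p = 0" using poly_roots_finite by blast
  then show "f x = g x" using p[of 1] by (simp add: L_def)
qed

lemma zonotopesI: "(\<Sum>j<m. closed_segment (a j) (b j)) \<in> zonotopes m"
  unfolding zonotopes_def by blast

text \<open>Padding with the degenerate segment at 0 replaces at most \<open>m\<close> generators by
  exactly \<open>m\<close>, each given by a base point and a direction.\<close>

lemma zonotopesE:
  assumes "A \<in> zonotopes m"
  obtains a d where "A = (\<Sum>j<m. closed_segment (a j) (a j + d j))"
proof -
  obtain r and a b :: "nat \<Rightarrow> real ^ 'a" where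
    r: "r \<le> m" "A = (\<Sum>j<r. closed_segment (a j) (b j))"
    using assms by (auto simp: zonotopes_def)
  define a' where "a' j = (if j < r then a j else 0)" for j
  define d where "d j = (if j < r then b j - a j else 0)" for j
  have "A = (\<Sum>j<m. closed_segment (a' j) (a' j + d j))"
    unfolding r(2)
    by (rule sum.mono_neutral_cong_left) (use r in \<open>auto simp: a'_def d_def\<close>)
  then show ?thesis by (rule that)
qed

text \<open>Generators of \<open>A\<close> are indexed by \<open>Inl j\<close> and have their
  variable set to 1; the generator of \<open>B i\<close> is \<open>Inr i\<close>, with variable
  \<open>x $ i\<close>. Only directions are recorded, since base points merely translate the
  body.\<close>

definition volume_polynomial ::
  "nat \<Rightarrow> (nat + 'k::finite \<Rightarrow> real ^ 'n::finite) \<Rightarrow> real ^ 'k \<Rightarrow> real" where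
  "volume_polynomial m v x =
    (\<Sum>S | S \<subseteq> {..<m} <+> UNIV \<and> card S = CARD('n).
      measure lebesgue (\<Sum>e\<in>S. closed_segment 0 (v e)) * prod (case_sum (\<lambda>_. 1) (($) x)) S)"

lemma real_polynomial_function_volume_polynomial:
  "real_polynomial_function (volume_polynomial m v)"
proof -
  have fin: "finite ({..<m} <+> (UNIV :: 'a set))" by simp
  have "real_polynomial_function (\<lambda>x :: real ^ 'a. case_sum (\<lambda>_. 1) (($) x) e)" for e :: "nat + 'a"
    by (cases e) (auto intro: real_polynomial_function.intros bounded_linear_vec_nth)
  then show ?thesis
    unfolding volume_polynomial_def
    by (intro real_polynomial_function_sum real_polynomial_function.intros(4)
        real_polynomial_function.intros(2) real_polynomial_function_prod)
       (auto intro: finite_subset[OF _ fin])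
qed

lemma sum_singletons: "(\<Sum>i\<in>I. {a i}) = {\<Sum>i\<in>I. a i}"
  by (induction I rule: infinite_finite_induct) (auto simp: set_plus_def)

lemma set_plus_singleton: "{a} + {b} = {a + b}"
  by (simp add: set_plus_def)

text \<open>All base points combine into one translation, which preserves volume;
  \<open>zonotope_volume\<close> handles the remaining segments from 0.\<close>

lemma volume_polynomial_eq_measure:
  fixes v :: "nat + 'k::finite \<Rightarrow> real ^ 'n::finite"
  assumes "\<forall>i. 0 \<le> x $ i"
  shows "volume_polynomial m v x = measure lebesgue
    ((\<Sum>j<m. closed_segment (a j) (a j + v (Inl j))) +
     (\<Sum>i\<in>UNIV. (\<lambda>v. x $ i *\<^sub>R v) ` closed_segment (b i) (b i + v (Inr i))))"
    (is "_ = measure _ ?A")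
proof -
  let ?y = "case_sum (\<lambda>_. 1) (($) x)"
  let ?Z = "\<Sum>e\<in>{..<m} <+> UNIV. closed_segment 0 (?y e *\<^sub>R v e)"
  have seg: "closed_segment c (c + d) = {c} + closed_segment 0 d" for c d :: "real ^ 'n"
    using closed_segment_eq_plus[of c "c + d"] by simp
  have img: "(\<lambda>v. t *\<^sub>R v) ` closed_segment c (c + d) =
      closed_segment (t *\<^sub>R c) (t *\<^sub>R c + t *\<^sub>R d)" for t and c d :: "real ^ 'n"
    by (simp add: closed_segment_linear_image[symmetric] scaleR_add_right)
  have "?A = {(\<Sum>j<m. a j) + (\<Sum>i\<in>UNIV. x $ i *\<^sub>R b i)} + ?Z"
    unfolding img unfolding seg sum.distrib sum_singletons
    by (simp add: sum.Plus add_ac set_plus_singleton[symmetric])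
  also have "\<dots> = (+) ((\<Sum>j<m. a j) + (\<Sum>i\<in>UNIV. x $ i *\<^sub>R b i)) ` ?Z"
    by (auto simp: set_plus_def)
  finally have "?A = (+) ((\<Sum>j<m. a j) + (\<Sum>i\<in>UNIV. x $ i *\<^sub>R b i)) ` ?Z" .
  then have "measure lebesgue ?A = measure lebesgue ?Z"
    by (simp only: measure_translation)
  moreover have "0 \<le> ?y e" for e using assms by (cases e) auto
  then have "measure lebesgue ?Z = volume_polynomial m v x"
    unfolding volume_polynomial_def by (intro zonotope_volume) auto
  ultimately show ?thesis by simp
qed

text \<open>A member of the diagram agrees with a volume polynomial on the positive orthant and,
  both being polynomials, everywhere. Conversely, segments starting at 0 realise any choice of
  directions.\<close>

lemma projection_diagram_eq:
  "projection_diagram TYPE('n::finite) m TYPE('k::finite) =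
    range (volume_polynomial m :: (nat + 'k \<Rightarrow> real ^ 'n) \<Rightarrow> _)"
proof (intro equalityI subsetI)
  fix f assume "f \<in> projection_diagram TYPE('n) m TYPE('k)"
  then obtain A and B :: "'k \<Rightarrow> (real ^ 'n) set" where f: "real_polynomial_function f"
    and AB: "A \<in> zonotopes m" "\<forall>i. B i \<in> zonotopes 1"
    and vol: "\<And>x. (\<forall>i. 0 \<le> x $ i) \<Longrightarrow>
      f x = measure lebesgue (A + (\<Sum>i\<in>UNIV. (\<lambda>v. x $ i *\<^sub>R v) ` B i))"
    by (auto simp: projection_diagram_def)
  obtain a d where A: "A = (\<Sum>j<m. closed_segment (a j) (a j + d j))"
    using AB(1) by (rule zonotopesE)
  have "\<exists>b c. B i = closed_segment b (b + c)" for i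
  proof -
    from AB(2) have "B i \<in> zonotopes 1" by simp
    then obtain b c where "B i = (\<Sum>j<1::nat. closed_segment (b j) (b j + c j))"
      by (rule zonotopesE)
    then have "B i = closed_segment (b 0) (b 0 + c 0)" by simp
    then show ?thesis by blast
  qed
  then obtain b where "\<And>i. \<exists>c. B i = closed_segment (b i) (b i + c)" by metis
  then obtain c where B: "\<And>i. B i = closed_segment (b i) (b i + c i)" by metis
  have "f = volume_polynomial m (case_sum d c)"
  proof (rule real_polynomial_function_eqI[OF f real_polynomial_function_volume_polynomial])
    fix x :: "real ^ 'k" assume "\<forall>i. 0 < x $ i"
    then have x: "\<forall>i. 0 \<le> x $ i" by (simp add: less_imp_le)
    show "f x = volume_polynomial m (case_sum d c) x"
      unfolding volume_polynomial_eq_measure[OF x, where a = a and b = b] vol[OF x] A B by simp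
  qed
  then show "f \<in> range (volume_polynomial m :: (nat + 'k \<Rightarrow> real ^ 'n) \<Rightarrow> _)" by blast
next
  fix f assume "f \<in> range (volume_polynomial m :: (nat + 'k \<Rightarrow> real ^ 'n) \<Rightarrow> _)"
  then obtain v :: "nat + 'k \<Rightarrow> real ^ 'n" where f: "f = volume_polynomial m v" by blast
  have "(\<Sum>j<m. closed_segment 0 (0 + v (Inl j))) \<in> zonotopes m"
    by (rule zonotopesI)
  moreover have "closed_segment 0 (0 + v (Inr i)) \<in> zonotopes 1" for i
    using zonotopesI[of "\<lambda>_. 0" "\<lambda>_. 0 + v (Inr i)" 1] by simp
  moreover have "f x = measure lebesgue ((\<Sum>j<m. closed_segment 0 (0 + v (Inl j))) +
      (\<Sum>i\<in>UNIV. (\<lambda>v. x $ i *\<^sub>R v) ` closed_segment 0 (0 + v (Inr i))))"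
    if "\<forall>i. 0 \<le> x $ i" for x
    unfolding f using volume_polynomial_eq_measure[OF that, of m v "\<lambda>_. 0" "\<lambda>_. 0"] .
  moreover have "real_polynomial_function f"
    unfolding f by (rule real_polynomial_function_volume_polynomial)
  ultimately show "f \<in> projection_diagram TYPE('n) m TYPE('k)"
    unfolding projection_diagram_def
    by (intro CollectI conjI bexI[of _ "\<Sum>j<m. closed_segment 0 (0 + v (Inl j))"]
        exI[of _ "\<lambda>i. closed_segment 0 (0 + v (Inr i))"]) auto
qed

section \<open>The reciprocal substitution\<close>

text \<open>The index set has \<open>CARD('n) + CARD('p)\<close> elements, so complementation
  exchanges the subsets of these two sizes. The Gale dual matches the coefficients, and the
  substitution matches the monomials.\<close>

lemma ex_reciprocal_volume_polynomial:
  assumes card: "CARD('n::finite) + CARD('p::finite) = m + CARD('k::finite)"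
    and "f \<in> projection_diagram TYPE('n) m TYPE('k)"
  shows "\<exists>g \<in> projection_diagram TYPE('p) m TYPE('k). \<forall>x. (\<forall>i. x $ i \<noteq> 0) \<longrightarrow>
    g x = (\<Prod>i\<in>UNIV. x $ i) * f (\<chi> i. inverse (x $ i))"
proof -
  obtain v :: "nat + 'k \<Rightarrow> real ^ 'n" where f: "f = volume_polynomial m v"
    using assms by (auto simp: projection_diagram_eq)
  let ?E = "{..<m} <+> (UNIV :: 'k set)"
  have fin: "finite ?E" by simp
  have cardE: "card ?E = CARD('n) + CARD('p)" using card by (simp add: card_Plus)
  obtain w :: "nat + 'k \<Rightarrow> real ^ 'p" where
    w: "\<And>S. S \<subseteq> ?E \<Longrightarrow> card S = CARD('n) \<Longrightarrow>
      measure lebesgue (\<Sum>e\<in>S. closed_segment 0 (v e)) =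
      measure lebesgue (\<Sum>e\<in>?E - S. closed_segment 0 (w e))"
    using ex_gale_dual[OF fin cardE, of v] by blast
  have "volume_polynomial m w x = (\<Prod>i\<in>UNIV. x $ i) * f (\<chi> i. inverse (x $ i))"
    if x: "\<forall>i. x $ i \<noteq> 0" for x
  proof -
    let ?y = "case_sum (\<lambda>_. 1) (($) x)"
    let ?z = "case_sum (\<lambda>_. 1) (($) (\<chi> i. inverse (x $ i)))"
    have z: "?z e = inverse (?y e)" "?y e \<noteq> 0" for e
      using x by (cases e; simp)+
    have prodE: "prod ?y ?E = (\<Prod>i\<in>UNIV. x $ i)" by (simp add: prod.Plus)
    \<comment> \<open>The factors from \<open>A\<close> are 1, so the full product is the product of
      all \<open>x $ i\<close>; dividing it by the monomial of \<open>S\<close> leaves that of the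
      complement.\<close>
    have compl: "prod ?y (?E - S) = prod ?y ?E * prod ?z S" if "S \<subseteq> ?E" for S
    proof -
      have "prod ?y S * prod ?z S = 1"
        unfolding prod.distrib[symmetric] z(1) by (intro prod.neutral ballI right_inverse z(2))
      moreover have "prod ?y ?E = prod ?y (?E - S) * prod ?y S"
        by (rule prod.subset_diff[OF that fin])
      ultimately show ?thesis by (simp only: mult.assoc mult_1_right)
    qed
    have cardC: "card (?E - S) = CARD('n) + CARD('p) - card S" if "S \<subseteq> ?E" for S
      using that fin cardE finite_subset by (metis card_Diff_subset)
    have "volume_polynomial m w x = (\<Sum>S | S \<subseteq> ?E \<and> card S = CARD('n).
        measure lebesgue (\<Sum>e\<in>?E - S. closed_segment 0 (w e)) * prod ?y (?E - S))"
      unfolding volume_polynomial_def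
      by (rule sum.reindex_bij_witness[where i = "\<lambda>S. ?E - S" and j = "\<lambda>S. ?E - S"])
         (use cardC in \<open>auto simp: double_diff\<close>)
    also have "\<dots> = (\<Sum>S | S \<subseteq> ?E \<and> card S = CARD('n).
        prod ?y ?E * (measure lebesgue (\<Sum>e\<in>S. closed_segment 0 (v e)) * prod ?z S))"
      by (intro sum.cong refl) (simp add: w compl)
    also have "\<dots> = (\<Prod>i\<in>UNIV. x $ i) * f (\<chi> i. inverse (x $ i))"
      unfolding f volume_polynomial_def sum_distrib_left prodE ..
    finally show ?thesis .
  qed
  then show ?thesis by (auto simp: projection_diagram_eq)
qed

theorem theorem3p1:
  fixes m :: nat
  assumes "m \<ge> 1"
    and "int CARD('p::finite) = int m + int CARD('k::finite) - int CARD('n::finite)"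
  shows "\<exists>\<Phi> :: (real ^ 'k \<Rightarrow> real) \<Rightarrow> (real ^ 'k \<Rightarrow> real).
    bij_betw \<Phi> (projection_diagram TYPE('n) m TYPE('k)) (projection_diagram TYPE('p) m TYPE('k)) \<and>
    (\<forall>f \<in> projection_diagram TYPE('n) m TYPE('k). \<forall>x. (\<forall>i. x $ i \<noteq> 0) \<longrightarrow>
       \<Phi> f x = (\<Prod>i\<in>UNIV. x $ i) * f (\<chi> i. inverse (x $ i)))"
proof -
  let ?D = "projection_diagram TYPE('n) m TYPE('k)"
  let ?D' = "projection_diagram TYPE('p) m TYPE('k)"
  \<comment> \<open>The reciprocal formula is imposed only where no coordinate is 0, since
    \<open>inverse 0 = 0\<close>. A polynomial function \<open>g\<close> is nevertheless determined
    by \<open>R f g\<close>, and the values of \<Phi> are chosen through this relation.\<close>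
  define R :: "(real ^ 'k \<Rightarrow> real) \<Rightarrow> (real ^ 'k \<Rightarrow> real) \<Rightarrow> bool" where
    "R f g \<longleftrightarrow> (\<forall>x. (\<forall>i. x $ i \<noteq> 0) \<longrightarrow>
      g x = (\<Prod>i\<in>UNIV. x $ i) * f (\<chi> i. inverse (x $ i)))" for f g
  have card: "CARD('n) + CARD('p) = m + CARD('k)" "CARD('p) + CARD('n) = m + CARD('k)"
    using assms(2) by linarith+
  \<comment> \<open>The substitution is an involution on points with nonzero coordinates.\<close>
  have R_sym: "R g f" if "R f g" for f g
    unfolding R_def
  proof (intro allI impI)
    fix x :: "real ^ 'k" assume x: "\<forall>i. x $ i \<noteq> 0"
    have "(\<chi> i. inverse ((\<chi> i. inverse (x $ i)) $ i)) = x" by (simp add: vec_eq_iff)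
    then have "g (\<chi> i. inverse (x $ i)) = (\<Prod>i\<in>UNIV. inverse (x $ i)) * f x"
      using that x unfolding R_def by (auto dest!: spec[of _ "\<chi> i. inverse (x $ i)"])
    then show "f x = (\<Prod>i\<in>UNIV. x $ i) * g (\<chi> i. inverse (x $ i))"
      using x by (simp add: prod_inversef[unfolded o_def])
  qed
  have R_unique: "g = g'"
    if "R f g" "R f g'" "real_polynomial_function g" "real_polynomial_function g'" for f g g'
  proof (rule real_polynomial_function_eqI[OF that(3,4)])
    fix x :: "real ^ 'k" assume "\<forall>i. 0 < x $ i"
    then have "\<forall>i. x $ i \<noteq> 0" by (metis less_irrefl)
    then show "g x = g' x" using that(1,2) by (simp add: R_def)
  qed
  have poly: "real_polynomial_function f" if "f \<in> ?D \<or> f \<in> ?D'" for f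
    using that by (auto simp: projection_diagram_def)
  have "\<forall>f\<in>?D. \<exists>g. g \<in> ?D' \<and> R f g"
    using ex_reciprocal_volume_polynomial[OF card(1)] unfolding R_def by blast
  from bchoice[OF this] obtain \<Phi> where \<Phi>: "\<forall>f\<in>?D. \<Phi> f \<in> ?D' \<and> R f (\<Phi> f)" ..
  \<comment> \<open>The cardinality condition is symmetric in \<open>'n\<close> and
    \<open>'p\<close>, so existence also holds from the second diagram to the first; with
    \<open>R_sym\<close> this yields preimages under \<Phi>.\<close>
  have surj: "\<exists>f\<in>?D. R g f" if "g \<in> ?D'" for g
    using ex_reciprocal_volume_polynomial[OF card(2) that] unfolding R_def by blast
  have "bij_betw \<Phi> ?D ?D'"
    unfolding bij_betw_def
  proof (intro conjI equalityI subsetI)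
    show "inj_on \<Phi> ?D"
    proof (rule inj_onI)
      fix f f' assume f: "f \<in> ?D" "f' \<in> ?D" "\<Phi> f = \<Phi> f'"
      then have "R (\<Phi> f) f" "R (\<Phi> f) f'" using \<Phi> R_sym by force+
      then show "f = f'" using f poly by (intro R_unique) auto
    qed
    show "g \<in> \<Phi> ` ?D" if g: "g \<in> ?D'" for g
    proof -
      obtain f where f: "f \<in> ?D" "R g f" using surj[OF g] by blast
      then have "R f g" "R f (\<Phi> f)" using \<Phi> R_sym by blast+
      then have "g = \<Phi> f" using f g \<Phi> poly by (intro R_unique) auto
      with f show ?thesis by blast
    qed
  qed (use \<Phi> in auto)
  then show ?thesis using \<Phi> unfolding R_def by blast
qed

end
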